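(* Let $k\in\mathbb N$, $k\ge 2$. The poset $(\mathfrak L_{\mathrm{Clo}^k},\subseteq)$ of all $k$-clones on $\{0,1\}$ embeds into the product poset \[(\mathfrak L_{\mathrm{sClo}^k},\subseteq)\times\prod_{i=1}^{2k}\Big((\mathfrak L_{\mathrm{Clo}^{k-1}}\cup\{\emptyset\},\subseteq)\times(\{0,1\},\le)\Big),\] where $\mathfrak L_{\mathrm{sClo}^k}$ is the set of surjective $k$-clones on $\{0,1\}$, $\mathfrak L_{\mathrm{Clo}^{k-1}}$ is the set of $(k-1)$-clones on $\{0,1\}$, and $\le$ is the usual order on $\{0,1\}$.
   Context: $E_k=\{1,\dots,k\}$. A $k$-operation of arity $n$ on $\{0,1\}$ is a $k$-tuple $\boldsymbol f=(\boldsymbol f^{(1)},\dots,\boldsymbol f^{(k)})$ of functions $\{0,1\}^n\to\{0,1\}$; $\mathcal O^k_{\{0,1\}}$ is the set of all of them (over all $n\ge1$). Composition is coordinatewise: for $m$-ary $\boldsymbol f$ and $n$-ary $\boldsymbol g_1,\dots,\boldsymbol g_m$, $\boldsymbol h^{(i)}=\boldsymbol f^{(i)}(\boldsymbol g_1^{(i)},\dots,\boldsymbol g_m^{(i)})$. A $k$-clone is a subset of $\mathcal O^k_{\{0,1\}}$ closed under composition and containing all $k$-projections (each component equal to $(x_1,\dots,x_n)\mapsto x_i$). $\mathrm{Clo}^k\mathcal F$ is the smallest $k$-clone containing $\mathcal F$; $\boldsymbol f$ is surjective if every component is surjective; $\mathrm{sClo}^k\mathcal F$ is the set of surjective members of $\mathrm{Clo}^k\mathcal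 F$; a surjective $k$-clone is a set $\mathcal C$ with $\mathrm{sClo}^k\mathcal C=\mathcal C$. A poset $(Q,\preceq)$ embeds into $(P,\le)$ if there is an injective map $\nu:Q\to P$ with $p\preceq q\Rightarrow\nu(p)\le\nu(q)$. Products of posets are ordered componentwise. *)

theory Defs
  imports Main "HOL-Library.FuncSet"
begin

text \<open>
  The two-element set \<open>{0,1}\<close> underlying the operations is the type \<^typ>\<open>bool\<close>. An element of
  \<open>{0,1}\<^sup>n\<close> is a list of length \<open>n\<close>. A \<open>k\<close>-operation carries its arity explicitly, and its component
  functions are extensional (\<^const>\<open>undefined\<close> outside their domain), so that equality in HOL is
  equality of \<open>k\<close>-operations.
\<close>

type_synonym kop = "nat \<times> (nat \<Rightarrow> bool list \<Rightarrow> bool)"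

abbreviation arity :: "kop \<Rightarrow> nat" where
  "arity f \<equiv> fst f"

abbreviation component :: "kop \<Rightarrow> nat \<Rightarrow> bool list \<Rightarrow> bool" where
  "component f \<equiv> snd f"

definition tuples :: "nat \<Rightarrow> bool list set" where
  "tuples n = {xs. length xs = n}"

definition kops :: "nat \<Rightarrow> kop set" where
  "kops k = {f. 1 \<le> arity f \<and> component f \<in> {1..k} \<rightarrow>\<^sub>E (tuples (arity f) \<rightarrow>\<^sub>E UNIV)}"

text \<open>The arguments of a projection are numbered from \<open>0\<close> to \<open>n - 1\<close>.\<close>

definition kproj :: "nat \<Rightarrow> nat \<Rightarrow> nat \<Rightarrow> kop" where
  "kproj k n j = (n, \<lambda>i\<in>{1..k}. \<lambda>xs\<in>tuples n. xs ! j)"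

text \<open>The parameter \<open>n\<close> is the common arity of the inner operations \<open>gs\<close>.\<close>

definition kcomp :: "nat \<Rightarrow> nat \<Rightarrow> kop \<Rightarrow> kop list \<Rightarrow> kop" where
  "kcomp k n f gs =
     (n, \<lambda>i\<in>{1..k}. \<lambda>xs\<in>tuples n. component f i (map (\<lambda>g. component g i xs) gs))"

definition kclone :: "nat \<Rightarrow> kop set \<Rightarrow> bool" where
  "kclone k C \<longleftrightarrow>
     C \<subseteq> kops k \<and>
     (\<forall>n j. j < n \<longrightarrow> kproj k n j \<in> C) \<and>
     (\<forall>n. \<forall>f\<in>C. \<forall>gs. length gs = arity f \<and> set gs \<subseteq> {g \<in> C. arity g = n} \<longrightarrow>
        kcomp k n f gs \<in> C)"

definition Clo :: "nat \<Rightarrow> kop set \<Rightarrow> kop set" where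
  "Clo k F = \<Inter>{C. kclone k C \<and> F \<subseteq> C}"

definition ksurjective :: "nat \<Rightarrow> kop \<Rightarrow> bool" where
  "ksurjective k f \<longleftrightarrow> (\<forall>i\<in>{1..k}. component f i ` tuples (arity f) = UNIV)"

definition sClo :: "nat \<Rightarrow> kop set \<Rightarrow> kop set" where
  "sClo k F = {f \<in> Clo k F. ksurjective k f}"

definition kclones :: "nat \<Rightarrow> kop set set" where
  "kclones k = {C. kclone k C}"

definition surj_kclones :: "nat \<Rightarrow> kop set set" where
  "surj_kclones k = {C. C \<subseteq> kops k \<and> sClo k C = C}"

text \<open>Posets are given by a carrier set and an order relation; embeddings need not reflect the order.\<close>

definition poset_embeds ::
    "'a set \<Rightarrow> ('a \<Rightarrow> 'a \<Rightarrow> bool) \<Rightarrow> 'b set \<Rightarrow> ('b \<Rightarrow> 'b \<Rightarrow> bool) \<Rightarrow> bool" where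
  "poset_embeds Q leQ P leP \<longleftrightarrow>
     (\<exists>\<nu>. \<nu> \<in> Q \<rightarrow> P \<and> inj_on \<nu> Q \<and> monotone_on Q leQ leP \<nu>)"

definition le_family :: "'i set \<Rightarrow> ('a \<Rightarrow> 'a \<Rightarrow> bool) \<Rightarrow> ('i \<Rightarrow> 'a) \<Rightarrow> ('i \<Rightarrow> 'a) \<Rightarrow> bool" where
  "le_family I le x y \<longleftrightarrow> (\<forall>i\<in>I. le (x i) (y i))"

lemma kclone_kops: "kclone k (kops k)"
  unfolding kclone_def
proof (intro conjI allI impI ballI)
  fix n f gs
  assume f: "f \<in> kops k" and gs: "length gs = arity f \<and> set gs \<subseteq> {g \<in> kops k. arity g = n}"
  then have "gs \<noteq> []" by (auto simp: kops_def)
  then obtain g where "g \<in> set gs" by (cases gs) auto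
  with gs have "1 \<le> n" by (auto simp: kops_def)
  then show "kcomp k n f gs \<in> kops k" by (simp add: kops_def kcomp_def)
qed (auto simp: kops_def kproj_def)

lemma kclone_Clo:
  assumes "F \<subseteq> kops k"
  shows "kclone k (Clo k F)"
proof -
  have sub: "Clo k F \<subseteq> kops k"
    using assms kclone_kops unfolding Clo_def by blast
  show ?thesis
    unfolding kclone_def
  proof (intro conjI allI impI ballI sub)
    fix n f gs
    assume f: "f \<in> Clo k F" and gs: "length gs = arity f \<and> set gs \<subseteq> {g \<in> Clo k F. arity g = n}"
    show "kcomp k n f gs \<in> Clo k F"
      unfolding Clo_def
    proof (rule InterI)
      fix C assume C: "C \<in> {C. kclone k C \<and> F \<subseteq> C}"
      then have "Clo k F \<subseteq> C" unfolding Clo_def by blast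
      with f gs have "f \<in> C" "length gs = arity f" "set gs \<subseteq> {g \<in> C. arity g = n}" by auto
      with C show "kcomp k n f gs \<in> C" unfolding kclone_def by blast
    qed
  qed (auto simp: Clo_def kclone_def)
qed

lemma subset_Clo: "F \<subseteq> Clo k F"
  unfolding Clo_def by blast

lemma Clo_least: "kclone k C \<Longrightarrow> F \<subseteq> C \<Longrightarrow> Clo k F \<subseteq> C"
  unfolding Clo_def by blast

end

theory Submission imports Defs begin

text \<open>
  A \<open>k\<close>-clone \<open>C\<close> is the union of its surjective part and, over all coordinates \<open>i\<close> and bits \<open>a\<close>,
  of the sets of those members whose \<open>i\<close>-th component is constantly \<open>a\<close>. Deleting the \<open>i\<close>-th
  component loses nothing on such a set, but the result \<open>D\<close> may lack projections. Adding all
  projections makes it a \<open>(k-1)\<close>-clone, and since \<open>D\<close> contains either all projections or none, one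
  further bit recovers \<open>D\<close>.
\<close>

section \<open>Deleting a component of an operation\<close>

definition skip :: "nat \<Rightarrow> nat \<Rightarrow> nat" where
  "skip i j = (if j < i then j else Suc j)"

text \<open>Here \<open>k\<close> counts the components that remain, so \<open>f\<close> is meant to
  have \<open>Suc k\<close>. For \<open>i\<close> in \<open>{1..Suc k}\<close>,
  \<open>skip i\<close> enumerates the other indices in increasing order.\<close>

definition del :: "nat \<Rightarrow> nat \<Rightarrow> kop \<Rightarrow> kop" where
  "del k i f = (arity f, \<lambda>j\<in>{1..k}. component f (skip i j))"

definition const_at :: "nat \<Rightarrow> bool \<Rightarrow> kop \<Rightarrow> bool" where
  "const_at i a f \<longleftrightarrow> (\<forall>xs\<in>tuples (arity f). component f i xs = a)"

definition const_part :: "nat \<Rightarrow> bool \<Rightarrow> kop set \<Rightarrow> kop set" where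
  "const_part i a C = {f \<in> C. const_at i a f}"

definition kprojs :: "nat \<Rightarrow> kop set" where
  "kprojs k = {kproj k n j | n j. j < n}"

lemma skip_mem: "j \<in> {1..k} \<Longrightarrow> skip i j \<in> {1..Suc k}"
  by (auto simp: skip_def)

lemma skip_surj:
  assumes "j \<in> {1..Suc k}" "i \<in> {1..Suc k}" "j \<noteq> i"
  obtains l where "l \<in> {1..k}" "j = skip i l"
proof (cases "j < i")
  case True
  with assms show ?thesis by (intro that[of j]) (auto simp: skip_def)
next
  case False
  with assms show ?thesis by (intro that[of "j - 1"]) (auto simp: skip_def)
qed

lemma kop_eqI:
  assumes "f \<in> kops k" "g \<in> kops k" "arity f = arity g"
    and "\<And>i xs. i \<in> {1..k} \<Longrightarrow> xs \<in> tuples (arity f) \<Longrightarrow> component f i xs = component g i xs"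
  shows "f = g"
proof (rule prod_eqI)
  have f: "component f \<in> {1..k} \<rightarrow>\<^sub>E (tuples (arity f) \<rightarrow>\<^sub>E UNIV)"
    and g: "component g \<in> {1..k} \<rightarrow>\<^sub>E (tuples (arity f) \<rightarrow>\<^sub>E UNIV)"
    using assms(1-3) by (auto simp: kops_def)
  show "component f = component g"
  proof (rule PiE_ext[OF f g])
    fix i assume i: "i \<in> {1..k}"
    show "component f i = component g i"
      by (rule PiE_ext[OF PiE_mem[OF f i] PiE_mem[OF g i]]) (use assms(4) i in auto)
  qed
qed (use assms in auto)

lemma kcomp_kproj:
  assumes "set gs \<subseteq> {g \<in> kops k. arity g = n}" "j < length gs"
  shows "kcomp k n (kproj k (length gs) j) gs = gs ! j"
proof (rule kop_eqI[of _ k])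
  have g: "gs ! j \<in> kops k" "arity (gs ! j) = n"
    using assms nth_mem by blast+
  then show "gs ! j \<in> kops k" "arity (kcomp k n (kproj k (length gs) j) gs) = arity (gs ! j)"
    by (auto simp: kcomp_def)
  show "kcomp k n (kproj k (length gs) j) gs \<in> kops k"
    using g by (auto simp: kcomp_def kops_def)
qed (use assms in \<open>auto simp: kcomp_def kproj_def tuples_def\<close>)

text \<open>On \<open>{1..k}\<close> the values of \<open>skip i\<close> stay in
  \<open>{1..Suc k}\<close>, so re-indexing never picks up the default
  \<open>undefined\<close>.\<close>

lemma del_kproj: "del k i (kproj (Suc k) n j) = kproj k n j"
  using skip_mem[of _ k i] by (auto simp: del_def kproj_def fun_eq_iff restrict_def)

lemma del_kcomp:
  assumes "set gs \<subseteq> {g. arity g = n}"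
  shows "del k i (kcomp (Suc k) n f gs) = kcomp k n (del k i f) (map (del k i) gs)"
  using assms skip_mem[of _ k i]
  by (auto simp: del_def kcomp_def fun_eq_iff restrict_def comp_def)

lemma del_kops: "f \<in> kops (Suc k) \<Longrightarrow> del k i f \<in> kops k"
  using skip_mem[of _ k i] by (force simp: kops_def del_def PiE_iff)

text \<open>Every index other than \<open>i\<close> is hit by \<open>skip i\<close>, so the deletion
  determines those components, and the common constant \<open>a\<close> supplies the missing
  one.\<close>

lemma del_const_at_inj:
  assumes "f \<in> kops (Suc k)" "g \<in> kops (Suc k)" "i \<in> {1..Suc k}"
    and "const_at i a f" "const_at i a g" "del k i f = del k i g"
  shows "f = g"
proof (rule kop_eqI[OF assms(1,2)])
  show ar: "arity f = arity g"
    using assms(6) by (simp add: del_def)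
  fix j xs assume j: "j \<in> {1..Suc k}" and xs: "xs \<in> tuples (arity f)"
  show "component f j xs = component g j xs"
  proof (cases "j = i")
    case True
    with assms(4,5) xs ar show ?thesis by (simp add: const_at_def)
  next
    case False
    then obtain l where l: "l \<in> {1..k}" "j = skip i l"
      using skip_surj j assms(3) by metis
    have "component (del k i f) l = component (del k i g) l"
      using assms(6) by simp
    with l show ?thesis by (simp add: del_def)
  qed
qed

section \<open>Clones from deletion and constant parts\<close>

lemma kclone_kcomp:
  assumes "kclone k C" "f \<in> C" "length gs = arity f" "set gs \<subseteq> {g \<in> C. arity g = n}"
  shows "kcomp k n f gs \<in> C"
  using assms unfolding kclone_def by blast

lemma kclone_kops_subset: "kclone k C \<Longrightarrow> C \<subseteq> kops k"
  by (simp add: kclone_def)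

lemma kclone_kprojs_subset: "kclone k C \<Longrightarrow> kprojs k \<subseteq> C"
  by (auto simp: kclone_def kprojs_def)

text \<open>Deletion respects projections and composition, so closure follows by lifting operations
  to \<open>C\<close>, composing there and deleting again.\<close>

lemma kclone_del_image:
  assumes "kclone (Suc k) C"
  shows "kclone k (del k i ` C)"
  unfolding kclone_def
proof (intro conjI allI impI ballI)
  show "del k i ` C \<subseteq> kops k"
    using kclone_kops_subset[OF assms] del_kops by blast
next
  fix n j :: nat assume "j < n"
  then have "kproj (Suc k) n j \<in> C"
    using assms by (simp add: kclone_def)
  then show "kproj k n j \<in> del k i ` C"
    using del_kproj by (metis imageI)
next
  fix n f gs assume "f \<in> del k i ` C"
    and gs: "length gs = arity f \<and> set gs \<subseteq> {g \<in> del k i ` C. arity g = n}"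
  then obtain f' where f': "f' \<in> C" "f = del k i f'" by blast
  have "gs \<in> lists (del k i ` C)" using gs by auto
  then obtain gs' where gs': "set gs' \<subseteq> C" "gs = map (del k i) gs'"
    unfolding lists_image by auto
  \<comment> \<open>Deletion keeps the arity, so the lifted arguments have arity \<open>n\<close>
    too.\<close>
  have ar: "set gs' \<subseteq> {g. arity g = n}"
    using gs gs'(2) by (auto simp: del_def)
  have "kcomp (Suc k) n f' gs' \<in> C"
    using gs gs' f' ar by (intro kclone_kcomp[OF assms]) (auto simp: del_def)
  moreover have "kcomp k n f gs = del k i (kcomp (Suc k) n f' gs')"
    using del_kcomp[OF ar] f' gs' by simp
  ultimately show "kcomp k n f gs \<in> del k i ` C" by simp
qed

lemma const_at_kcomp:
  assumes "const_at i a f" "i \<in> {1..k}" "length gs = arity f"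
  shows "const_at i a (kcomp k n f gs)"
  using assms by (simp add: const_at_def kcomp_def tuples_def)

text \<open>Split on the outer operation: one that is constant at \<open>i\<close> stays so under
  any substitution, and a projection returns one of its arguments.\<close>

lemma kclone_const_part_kprojs:
  assumes "kclone k C" "i \<in> {1..k}"
  shows "kclone k (const_part i a C \<union> kprojs k)"
  unfolding kclone_def
proof (intro conjI allI impI ballI)
  have sub: "const_part i a C \<union> kprojs k \<subseteq> C"
    using kclone_kprojs_subset[OF assms(1)] by (auto simp: const_part_def)
  then show "const_part i a C \<union> kprojs k \<subseteq> kops k"
    using kclone_kops_subset[OF assms(1)] by blast
  fix n f gs assume f: "f \<in> const_part i a C \<union> kprojs k"
    and gs: "length gs = arity f \<and> set gs \<subseteq> {g \<in> const_part i a C \<union> kprojs k. arity g = n}"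
  from f show "kcomp k n f gs \<in> const_part i a C \<union> kprojs k"
  proof
    assume "f \<in> const_part i a C"
    moreover have "kcomp k n f gs \<in> C"
      using f gs sub by (intro kclone_kcomp[OF assms(1)]) auto
    ultimately show ?thesis
      using const_at_kcomp assms(2) gs by (auto simp: const_part_def)
  next
    assume "f \<in> kprojs k"
    then obtain j where j: "f = kproj k (length gs) j" "j < length gs"
      using gs by (auto simp: kprojs_def kproj_def)
    have "set gs \<subseteq> {g \<in> kops k. arity g = n}"
      using gs sub kclone_kops_subset[OF assms(1)] by blast
    then have "kcomp k n f gs = gs ! j"
      using kcomp_kproj j by simp
    moreover have "gs ! j \<in> set gs" using j(2) by simp
    ultimately show ?thesis using gs by auto
  qed
qed (auto simp: kprojs_def)

text \<open>If deletion turns one member of the constant part into a projection, substituting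
  projections from \<open>C\<close> into that member yields all others. So the unary projection can
  stand for all of them.\<close>

lemma kproj_del_const_part_iff:
  assumes C: "kclone (Suc k) C" and i: "i \<in> {1..Suc k}" and "j < n"
  shows "kproj k n j \<in> del k i ` const_part i a C \<longleftrightarrow> kproj k 1 0 \<in> del k i ` const_part i a C"
proof -
  have change: "kproj k n' j' \<in> del k i ` const_part i a C"
    if f: "kproj k n j \<in> del k i ` const_part i a C" and "j < n" "j' < n'" for n j n' j'
  proof -
    obtain f where f: "f \<in> C" "const_at i a f" "del k i f = kproj k n j"
      using f by (auto simp: const_part_def)
    \<comment> \<open>All arguments are the same projection, so it does not matter which argument
      \<open>j\<close> the deletion of \<open>f\<close> selects.\<close>
    define gs where "gs = replicate n (kproj (Suc k) n' j')"
    have ar: "arity f = n" using f(3) by (simp add: del_def kproj_def)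
    have p: "kproj (Suc k) n' j' \<in> C" "kproj k n' j' \<in> kops k"
      using C kclone_kops that(3) by (auto simp: kclone_def)
    have "kcomp (Suc k) n' f gs \<in> const_part i a C"
      unfolding const_part_def using f p ar i
      by (auto simp: gs_def kproj_def intro!: kclone_kcomp[OF C] const_at_kcomp)
    moreover have "del k i (kcomp (Suc k) n' f gs)
        = kcomp k n' (kproj k n j) (replicate n (kproj k n' j'))"
      by (subst del_kcomp) (auto simp: gs_def f(3) del_kproj, simp add: kproj_def)
    moreover have "\<dots> = kproj k n' j'"
      using kcomp_kproj[of "replicate n (kproj k n' j')" k n' j] p that(2)
      by (auto simp: kproj_def)
    ultimately show ?thesis by (metis imageI)
  qed
  show ?thesis using change \<open>j < n\<close> zero_less_one by blast
qed

text \<open>Adding projections only blurs whether a projection already came from the constant part.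
  The hypothesis on the unary projection settles this, and \<open>del_const_at_inj\<close> lifts the
  inclusion back.\<close>

lemma const_part_subsetI:
  assumes C: "kclone (Suc k) C" and D: "kclone (Suc k) D" and i: "i \<in> {1..Suc k}"
    and im: "del k i ` (const_part i a C \<union> kprojs (Suc k)) \<subseteq> del k i ` (const_part i a D \<union> kprojs (Suc k))"
    and u: "kproj k 1 0 \<in> del k i ` const_part i a C \<Longrightarrow> kproj k 1 0 \<in> del k i ` const_part i a D"
  shows "const_part i a C \<subseteq> const_part i a D"
proof
  fix f assume f: "f \<in> const_part i a C"
  have "del k i f \<in> del k i ` const_part i a D"
  proof (rule ccontr)
    assume "del k i f \<notin> del k i ` const_part i a D"
    with f im have "del k i f \<in> del k i ` kprojs (Suc k)" by blast
    then obtain n j where "j < n" "del k i f = kproj k n j"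
      by (auto simp: kprojs_def del_kproj)
    with f u kproj_del_const_part_iff[OF C i] kproj_del_const_part_iff[OF D i]
      \<open>del k i f \<notin> del k i ` const_part i a D\<close>
    show False by (metis imageI)
  qed
  then obtain g where g: "g \<in> const_part i a D" "del k i f = del k i g" by blast
  have "f = g"
    using f g kclone_kops_subset[OF C] kclone_kops_subset[OF D] i
    by (intro del_const_at_inj[of f k g i a]) (auto simp: const_part_def)
  with g show "f \<in> const_part i a D" by simp
qed

section \<open>Surjective parts and the decomposition of a clone\<close>

lemma Clo_kclone: "kclone k C \<Longrightarrow> Clo k C = C"
  by (simp add: Clo_least subset_Clo subset_antisym)

text \<open>The clone generated by the surjective part lies between that part and \<open>C\<close>,
  so it has the same surjective members as \<open>C\<close>.\<close>

lemma sClo_surj_kclones: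
  assumes "kclone k C"
  shows "sClo k C \<in> surj_kclones k"
proof -
  have "sClo k C \<subseteq> C"
    by (auto simp: sClo_def Clo_kclone[OF assms])
  then show ?thesis
    using Clo_least[OF assms, of "sClo k C"] subset_Clo[of "sClo k C" k]
      kclone_kops_subset[OF assms]
    by (auto simp: surj_kclones_def sClo_def Clo_kclone[OF assms])
qed

text \<open>With only two values, a component that misses \<open>b\<close> is constantly
  \<open>\<not> b\<close>.\<close>

lemma not_ksurjective_const_at:
  assumes "\<not> ksurjective k f"
  obtains i a where "i \<in> {1..k}" "const_at i a f"
proof -
  obtain i b where i: "i \<in> {1..k}" "b \<notin> component f i ` tuples (arity f)"
    using assms unfolding ksurjective_def by blast
  then have "const_at i (\<not> b) f"
    unfolding const_at_def by blast
  with i that show ?thesis by blast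
qed

lemma kclone_subsetI:
  assumes C: "kclone k C" and D: "kclone k D" and "sClo k C \<subseteq> sClo k D"
    and "\<And>i a. i \<in> {1..k} \<Longrightarrow> const_part i a C \<subseteq> const_part i a D"
  shows "C \<subseteq> D"
proof
  fix f assume f: "f \<in> C"
  show "f \<in> D"
  proof (cases "ksurjective k f")
    case True
    with f assms(3) show ?thesis by (auto simp: sClo_def Clo_kclone[OF C] Clo_kclone[OF D])
  next
    case False
    then obtain i a where "i \<in> {1..k}" "const_at i a f"
      by (rule not_ksurjective_const_at)
    with f assms(4)[of i a] show ?thesis by (auto simp: const_part_def)
  qed
qed

text \<open>The index \<open>m\<close> encodes the coordinate \<open>(m + 1) div 2\<close> and the bit \<open>even m\<close>.\<close>

definition const_code :: "nat \<Rightarrow> kop set \<Rightarrow> nat \<Rightarrow> kop set \<times> nat" where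
  "const_code k C m =
     (let i = (m + 1) div 2; a = even m in
       (del k i ` (const_part i a C \<union> kprojs (Suc k)),
        of_bool (kproj k 1 0 \<in> del k i ` const_part i a C)))"

definition clone_code :: "nat \<Rightarrow> kop set \<Rightarrow> kop set \<times> (nat \<Rightarrow> kop set \<times> nat)" where
  "clone_code k C = (sClo (Suc k) C, \<lambda>m\<in>{1..2 * Suc k}. const_code k C m)"

section \<open>The code as an embedding\<close>

lemma clone_code_mem:
  assumes "kclone (Suc k) C"
  shows "clone_code k C \<in> surj_kclones (Suc k) \<times>
           ({1..2 * Suc k} \<rightarrow>\<^sub>E ((kclones k \<union> {{}}) \<times> {0, 1 :: nat}))"
proof -
  have "const_code k C m \<in> (kclones k \<union> {{}}) \<times> {0, 1 :: nat}" if "m \<in> {1..2 * Suc k}" for m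
  proof -
    have "(m + 1) div 2 \<in> {1..Suc k}" using that by auto
    then show ?thesis
      using kclone_del_image[OF kclone_const_part_kprojs[OF assms]]
      by (auto simp: const_code_def Let_def kclones_def)
  qed
  then show ?thesis
    using sClo_surj_kclones[OF assms] by (auto simp: clone_code_def)
qed

text \<open>The bit asks whether a fixed operation lies in a set that grows with the clone, so it is
  monotone like the other entries.\<close>

lemma clone_code_mono:
  assumes "kclone (Suc k) C" "kclone (Suc k) D" "C \<subseteq> D"
  shows "rel_prod (\<subseteq>) (le_family {1..2 * Suc k} (rel_prod (\<subseteq>) (\<le>))) (clone_code k C) (clone_code k D)"
proof -
  have "const_part i a C \<subseteq> const_part i a D" for i a
    using assms(3) by (auto simp: const_part_def)
  then have "rel_prod (\<subseteq>) (\<le>) (const_code k C m) (const_code k D m)" for m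
    unfolding const_code_def Let_def rel_prod_inject of_bool_def by auto
  moreover have "sClo (Suc k) C \<subseteq> sClo (Suc k) D"
    using assms by (auto simp: sClo_def Clo_kclone)
  ultimately show ?thesis
    by (simp add: clone_code_def le_family_def)
qed

text \<open>The entry at each index supplies both inputs of \<open>const_part_subsetI\<close>.
  Swapping \<open>C\<close> and \<open>D\<close> will give injectivity.\<close>

lemma clone_code_reflects:
  assumes C: "kclone (Suc k) C" and D: "kclone (Suc k) D" and eq: "clone_code k C = clone_code k D"
  shows "C \<subseteq> D"
proof (rule kclone_subsetI[OF C D])
  show "sClo (Suc k) C \<subseteq> sClo (Suc k) D"
    using eq by (simp add: clone_code_def)
  fix i a assume i: "i \<in> {1..Suc k}"
  \<comment> \<open>Inverse of the encoding: \<open>2 * i\<close> and \<open>2 * i - 1\<close> both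
    have coordinate \<open>i\<close>, and the even one stands for \<open>True\<close>.\<close>
  define m where "m = (if a then 2 * i else 2 * i - 1)"
  have m: "m \<in> {1..2 * Suc k}" "(m + 1) div 2 = i" "even m = a"
    using i by (auto simp: m_def)
  have "const_code k C m = const_code k D m"
    using eq m(1) unfolding clone_code_def by (metis Pair_inject restrict_apply')
  then show "const_part i a C \<subseteq> const_part i a D"
    unfolding const_code_def Let_def m(2,3) prod.inject of_bool_eq_iff
    by (intro const_part_subsetI[OF C D i]) auto
qed

theorem theorem5p8:
  fixes k :: nat
  assumes "k \<ge> 2"
  shows "poset_embeds
           (kclones k) (\<subseteq>)
           (surj_kclones k \<times>
              ({1..2 * k} \<rightarrow>\<^sub>E ((kclones (k - 1) \<union> {{}}) \<times> {0, 1 :: nat})))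
           (rel_prod (\<subseteq>) (le_family {1..2 * k} (rel_prod (\<subseteq>) (\<le>))))"
proof -
  \<comment> \<open>The predecessor \<open>l\<close> counts the components left after a
    deletion.\<close>
  obtain l where l: "k = Suc l" using assms by (cases k) auto
  have "inj_on (clone_code l) (kclones (Suc l))"
    unfolding kclones_def by (intro inj_onI subset_antisym) (metis clone_code_reflects mem_Collect_eq)+
  moreover have "clone_code l \<in> kclones (Suc l) \<rightarrow> surj_kclones (Suc l) \<times>
      ({1..2 * Suc l} \<rightarrow>\<^sub>E ((kclones l \<union> {{}}) \<times> {0, 1 :: nat}))"
    using clone_code_mem by (auto simp only: kclones_def Pi_iff mem_Collect_eq)
  moreover have "monotone_on (kclones (Suc l)) (\<subseteq>)
      (rel_prod (\<subseteq>) (le_family {1..2 * Suc l} (rel_prod (\<subseteq>) (\<le>)))) (clone_code l)"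
    using clone_code_mono by (auto simp only: kclones_def mem_Collect_eq intro!: monotone_onI)
  ultimately show ?thesis
    unfolding poset_embeds_def l diff_Suc_1 by blast
qed

end
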